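(* Let $f:\mathbb{R}^d\to\mathbb{R}$ be $\rho$-weakly convex with $\rho>0$. Let $\eta>0$ and define $f_\eta(x)=f^\beta(x)$ where $\beta=\rho+\max\{\eta^{-1},\rho\}$. Then $f_\eta$ is a $(2\rho,\mathcal{R}_\eta,\mathcal{L}_\eta)$-smooth approximation of $f$ on $\mathbb{R}^d$ with $$\mathcal{R}_\eta(x)=\frac{\eta}{2\max\{1,\rho\eta\}}\|\partial f(x)\|^2,\qquad \mathcal{L}_\eta(x,y)=2\rho+\eta^{-1}.$$
   Context: $\|\cdot\|$ is the Euclidean norm. A function $g$ is $\rho$-weakly convex if $g+\frac\rho2\|\cdot\|^2$ is convex. $\partial f$ is the Fréchet (= limiting) subdifferential, and $\|\partial f(x)\|:=\inf\{\|v\|:v\in\partial f(x)\}$. The Moreau envelope with parameter $\beta>\rho$ is $f^\beta(x):=\min_y\{f(y)+\frac\beta2\|y-x\|^2\}$. A continuously differentiable function $f_\eta:\mathbb{R}^d\to\mathbb{R}$ is a $(\bar\rho,\mathcal{R}_\eta,\mathcal{L}_\eta)$-smooth approximation of $f$ (with $\bar\rho>0$ a constant not depending on $\eta$, $\mathcal{R}_\eta:\mathbb{R}^d\to[0,\infty)$, $\mathcal{L}_\eta:\mathbb{R}^d\times\mathbb{R}^d\to[0,\infty)$ symmetric) if: $f_\eta$ is $\bar\rho$-weakly convex; $f_\eta(x)\le f(x)\le f_\eta(x)+\mathcal{R}_\eta(x)$ for all $x$; and $\|\nabla f_\eta(x)-\nabla f_\eta(y)\|\le\mathcal{L}_\eta(x,y)\|x-y\|$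 for all $x,y$. *)

theory Defs
  imports "HOL-Analysis.Analysis"
begin

definition weakly_convex :: "real \<Rightarrow> ('a::real_inner \<Rightarrow> real) \<Rightarrow> bool" where
  "weakly_convex \<rho> g \<longleftrightarrow> convex_on UNIV (\<lambda>x. g x + \<rho> / 2 * (norm x)\<^sup>2)"

definition frechet_subdiff :: "('a::real_inner \<Rightarrow> real) \<Rightarrow> 'a \<Rightarrow> 'a set" where
  "frechet_subdiff f x =
     {v. 0 \<le> Liminf (at x) (\<lambda>y. ereal ((f y - f x - inner v (y - x)) / norm (y - x)))}"

text \<open>The infimum is taken in the reals, so it is unspecified where the subdifferential is
  empty; this does not occur for a finite-valued weakly convex function on a Euclidean space.\<close>

definition subdiff_norm :: "('a::real_inner \<Rightarrow> real) \<Rightarrow> 'a \<Rightarrow> real" where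
  "subdiff_norm f x = (INF v\<in>frechet_subdiff f x. norm v)"

text \<open>The envelope is a minimum, not merely an infimum: the value is unspecified if the minimum
  is not attained.\<close>

definition moreau_envelope :: "real \<Rightarrow> ('a::real_inner \<Rightarrow> real) \<Rightarrow> 'a \<Rightarrow> real" where
  "moreau_envelope \<beta> f x = (LEAST m. m \<in> range (\<lambda>y. f y + \<beta> / 2 * (norm (y - x))\<^sup>2))"

text \<open>Gradients are unique, so the existentially quantified map \<open>g\<close> is the gradient of \<open>f\<^sub>\<eta>\<close>.\<close>

definition smooth_approximation ::
  "real \<Rightarrow> ('a::real_inner \<Rightarrow> real) \<Rightarrow> ('a \<Rightarrow> 'a \<Rightarrow> real) \<Rightarrow> ('a \<Rightarrow> real) \<Rightarrow> ('a \<Rightarrow> real) \<Rightarrow> bool" where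
  "smooth_approximation \<rho>' R L f f\<^sub>\<eta> \<longleftrightarrow>
     \<rho>' > 0 \<and>
     (\<forall>x. 0 \<le> R x) \<and>
     (\<forall>x y. 0 \<le> L x y \<and> L x y = L y x) \<and>
     weakly_convex \<rho>' f\<^sub>\<eta> \<and>
     (\<forall>x. f\<^sub>\<eta> x \<le> f x \<and> f x \<le> f\<^sub>\<eta> x + R x) \<and>
     (\<exists>g. (\<forall>x. GDERIV f\<^sub>\<eta> x :> g x) \<and> continuous_on UNIV g \<and>
          (\<forall>x y. norm (g x - g y) \<le> L x y * norm (x - y)))"

end

(* Write mu = beta - rho and let p be the minimiser in the definition of
   the envelope at x.  Then beta (x - p) is a Frechet subgradient of f at p, and weak convexity
   turns every Frechet subgradient v at a point z into the global bound
   f y >= f z + <v, y - z> - rho/2 |y - z|^2.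
   Minimising this bound plus beta/2 |y - z|^2 over y gives f z - |v|^2 / (2 mu), which is the
   estimate of f minus its envelope.
   Testing the envelope at x' with p bounds it above by a quadratic of curvature beta around x;
   the global bound at p bounds it below by one of curvature -rho beta / mu >= -2 rho, with the
   same linear part beta (x - p).  These bounds give the gradient and the weak convexity.
   Adding the global bounds at two proximal points gives mu |p' - p|^2 <= beta <x' - x, p' - p>,
   and mu >= beta / 2 then makes x - p nonexpansive. *)
theory Submission
  imports Defs
begin

section \<open>Weak convexity along segments and through quadratic minorants\<close>

lemma weakly_convexD:
  assumes "weakly_convex \<rho> f" "0 \<le> t" "t \<le> 1"
  shows "f (x + t *\<^sub>R (y - x)) \<le> (1 - t) * f x + t * f y + \<rho> / 2 * t * (1 - t) * (norm (y - x))\<^sup>2"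
proof -
  have "f ((1 - t) *\<^sub>R x + t *\<^sub>R y) + \<rho> / 2 * (norm ((1 - t) *\<^sub>R x + t *\<^sub>R y))\<^sup>2
      \<le> (1 - t) * (f x + \<rho> / 2 * (norm x)\<^sup>2) + t * (f y + \<rho> / 2 * (norm y)\<^sup>2)"
    using assms unfolding weakly_convex_def by (intro convex_onD) auto
  moreover have "(1 - t) *\<^sub>R x + t *\<^sub>R y = x + t *\<^sub>R (y - x)"
    by (simp add: algebra_simps)
  \<comment> \<open>The convexity defect of the squared norm is an exact multiple of the squared
    distance, so the added quadratic becomes a translation invariant error.\<close>
  moreover have "(1 - t) * (norm x)\<^sup>2 + t * (norm y)\<^sup>2 - (norm (x + t *\<^sub>R (y - x)))\<^sup>2
      = t * (1 - t) * (norm (y - x))\<^sup>2"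
    by (simp add: power2_norm_eq_inner inner_simps inner_commute algebra_simps)
  ultimately have "f (x + t *\<^sub>R (y - x)) \<le> (1 - t) * f x + t * f y
      + \<rho> / 2 * ((1 - t) * (norm x)\<^sup>2 + t * (norm y)\<^sup>2 - (norm (x + t *\<^sub>R (y - x)))\<^sup>2)"
    by (simp add: field_simps)
  with \<open>_ = t * (1 - t) * (norm (y - x))\<^sup>2\<close> show ?thesis
    by (simp add: mult.assoc)
qed

text \<open>Adding \<open>c / 2 * (norm x)\<^sup>2\<close> makes the quadratic minorants affine.
  Averaging the minorant at \<open>z\<close> over both endpoints cancels its linear terms, since
  \<open>z\<close> is their weighted mean.\<close>

lemma weakly_convexI:
  assumes "\<And>x y. F x + inner (g x) (y - x) - c / 2 * (norm (y - x))\<^sup>2 \<le> F y"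
  shows "weakly_convex c F"
  unfolding weakly_convex_def
proof (intro convex_onI)
  fix t :: real and x y :: 'a
  assume t: "0 < t" "t < 1"
  let ?G = "\<lambda>x. F x + c / 2 * (norm x)\<^sup>2"
  define z where "z = (1 - t) *\<^sub>R x + t *\<^sub>R y"
  define w where "w = g z + c *\<^sub>R z"
  have below: "?G z + inner w (u - z) \<le> ?G u" for u
  proof -
    have "c / 2 * (norm u)\<^sup>2 - c / 2 * (norm z)\<^sup>2 - c * inner z (u - z) = c / 2 * (norm (u - z))\<^sup>2"
      by (simp add: power2_norm_eq_inner inner_simps inner_commute algebra_simps)
    then show ?thesis
      using assms[of z u] by (simp add: w_def inner_add_left)
  qed
  have "(1 - t) * (?G z + inner w (x - z)) + t * (?G z + inner w (y - z))
      \<le> (1 - t) * ?G x + t * ?G y"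
    using t by (intro add_mono[OF mult_left_mono[OF below] mult_left_mono[OF below]]) auto
  moreover have "(1 - t) * (a + inner w (x - z)) + t * (a + inner w (y - z)) = a" for a
    by (simp add: z_def inner_simps algebra_simps)
  ultimately show "?G ((1 - t) *\<^sub>R x + t *\<^sub>R y) \<le> (1 - t) * ?G x + t * ?G y"
    unfolding z_def[symmetric] by simp
qed auto

section \<open>Subgradients of convex and weakly convex functions\<close>

lemma convex_on_subgradient_exists:
  fixes h :: "'a::euclidean_space \<Rightarrow> real"
  assumes "convex_on UNIV h"
  obtains v where "\<And>y. h x + inner v (y - x) \<le> h y"
proof -
  \<comment> \<open>The strict epigraph misses the point \<open>(x, h x)\<close>, so the two can be
    separated; the hyperplane's slope is the subgradient.\<close>
  define S where "S = {(y, t). h y < t}"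
  have "convex S"
    unfolding convex_def S_def
  proof (clarsimp)
    fix y t y' t' and u v :: real
    assume *: "h y < t" "h y' < t'" "0 \<le> u" "0 \<le> v" "u + v = 1"
    have "h (u *\<^sub>R y + v *\<^sub>R y') \<le> u * h y + v * h y'"
      using assms * unfolding convex_on_def by auto
    also have "\<dots> < u * t + v * t'"
    proof (cases "u = 0")
      case False
      then show ?thesis
        using * by (intro add_less_le_mono mult_strict_left_mono mult_left_mono) auto
    qed (use * in auto)
    finally show "h (u *\<^sub>R y + v *\<^sub>R y') < u * t + v * t'" .
  qed
  moreover have "(x, h x + 1) \<in> S"
    by (simp add: S_def)
  then have "S \<noteq> {}" by blast
  moreover have "{(x, h x)} \<inter> S = {}"
    by (auto simp: S_def)
  ultimately have "\<exists>a b. a \<noteq> 0 \<and> (\<forall>s\<in>{(x, h x)}. inner a s \<le> b) \<and> (\<forall>s\<in>S. b \<le> inner a s)"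
    by (intro separating_hyperplane_sets) auto
  then obtain a b where
    ab: "a \<noteq> 0" "inner a (x, h x) \<le> b" "\<And>s. s \<in> S \<Longrightarrow> b \<le> inner a s"
    by blast
  obtain u s where a: "a = (u, s)" by force
  have sep: "inner u x + s * h x \<le> inner u y + s * t" if "h y < t" for y t
    using ab(2) ab(3)[of "(y, t)"] that by (simp add: a S_def)
  have "s \<ge> 0"
    using sep[of x "h x + 1"] by (simp add: algebra_simps)
  \<comment> \<open>No vertical hyperplane can occur: \<open>h\<close> is finite everywhere, so
    moving from \<open>x\<close> by \<open>- u\<close> stays in the domain and forces
    \<open>u = 0\<close>.\<close>
  moreover have "s \<noteq> 0"
  proof
    assume "s = 0"
    then have "inner u u \<le> 0"
      using sep[of "x - u" "h (x - u) + 1"] by (simp add: inner_diff_right)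
    then have "u = 0"
      by (meson inner_gt_zero_iff not_le)
    with \<open>s = 0\<close> ab(1) show False
      by (simp add: a zero_prod_def)
  qed
  ultimately have "s > 0" by simp
  have "h x + inner (- u /\<^sub>R s) (y - x) \<le> h y" for y
  \<comment> \<open>Separation only speaks of heights strictly above \<open>h y\<close>; density of
    the reals reaches \<open>h y\<close> itself.\<close>
  proof (rule dense_ge)
    fix t assume "h y < t"
    from sep[OF this] show "h x + inner (- u /\<^sub>R s) (y - x) \<le> t"
      using \<open>s > 0\<close> by (simp add: inner_diff_right field_simps)
  qed
  then show ?thesis by (rule that)
qed

text \<open>Dividing a quadratic error by the distance leaves \<open>c * norm (y - x)\<close>, which
  vanishes at \<open>x\<close>.\<close>

lemma frechet_subdiffI:
  assumes "\<And>y. f x + inner v (y - x) - c * (norm (y - x))\<^sup>2 \<le> f y"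
  shows "v \<in> frechet_subdiff f x"
  unfolding frechet_subdiff_def mem_Collect_eq le_Liminf_iff
proof (intro allI impI)
  fix e :: ereal assume "e < 0"
  \<comment> \<open>The level \<open>e\<close> may be minus infinity, so a real level above it is
    used.\<close>
  then obtain r where r: "e < ereal r" "r < 0"
    using ereal_dense2 by fastforce
  have "((\<lambda>y. - c * norm (y - x)) \<longlongrightarrow> - c * norm (x - x)) (at x)"
    by (intro tendsto_intros)
  then have "eventually (\<lambda>y. r < - c * norm (y - x)) (at x)"
    using r(2) by (intro order_tendstoD(1)) auto
  moreover have "eventually (\<lambda>y. y \<noteq> x) (at x)"
    by (simp add: eventually_at_filter)
  ultimately show "eventually (\<lambda>y. e < ereal ((f y - f x - inner v (y - x)) / norm (y - x))) (at x)"
  proof eventually_elim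
    case (elim y)
    then have "- c * norm (y - x) \<le> (f y - f x - inner v (y - x)) / norm (y - x)"
      using assms[of y] by (simp add: field_simps power2_eq_square)
    with elim(1) have "ereal r < ereal ((f y - f x - inner v (y - x)) / norm (y - x))"
      by simp
    with r(1) show ?case by (rule less_trans)
  qed
qed

text \<open>From local to global: along the segment to \<open>y\<close>, the Frechet inequality
  bounds \<open>f\<close> below and weak convexity bounds it above. Divide by \<open>t\<close>, let
  \<open>t\<close> tend to 0, then the slack \<open>e\<close>.\<close>

lemma frechet_subdiff_weakly_convexD:
  assumes wc: "weakly_convex \<rho> f" and v: "v \<in> frechet_subdiff f x"
  shows "f x + inner v (y - x) - \<rho> / 2 * (norm (y - x))\<^sup>2 \<le> f y"
proof (cases "y = x")
  case False
  define d where "d = y - x"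
  have "d \<noteq> 0" using False by (simp add: d_def)
  have lim0: "((\<lambda>t. \<rho> / 2 * (1 - t) * (norm d)\<^sup>2) \<longlongrightarrow> \<rho> / 2 * (1 - 0) * (norm d)\<^sup>2) (at_right 0)"
    by (intro tendsto_intros)
  have approx: "inner v d - e * norm d - \<rho> / 2 * (norm d)\<^sup>2 \<le> f y - f x" if "e > 0" for e
  proof -
    have "ereal (- e) < 0" using that by simp
    then have "eventually (\<lambda>z. ereal (- e) < ereal ((f z - f x - inner v (z - x)) / norm (z - x))) (at x)"
      using v unfolding frechet_subdiff_def mem_Collect_eq le_Liminf_iff by blast
    moreover have "filterlim (\<lambda>t. x + t *\<^sub>R d) (at x) (at_right 0)"
    proof (rule filterlim_atI)
      have "((\<lambda>t. x + t *\<^sub>R d) \<longlongrightarrow> x + 0 *\<^sub>R d) (at_right 0)"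
        by (intro tendsto_intros)
      then show "((\<lambda>t. x + t *\<^sub>R d) \<longlongrightarrow> x) (at_right 0)" by simp
      show "eventually (\<lambda>t. x + t *\<^sub>R d \<noteq> x) (at_right 0)"
        using \<open>d \<noteq> 0\<close> by (auto simp: eventually_at_filter)
    qed
    ultimately have "eventually (\<lambda>t. ereal (- e)
        < ereal ((f (x + t *\<^sub>R d) - f x - inner v (x + t *\<^sub>R d - x)) / norm (x + t *\<^sub>R d - x))) (at_right 0)"
      by (rule eventually_compose_filterlim)
    moreover have "eventually (\<lambda>t::real. t \<in> {0<..<1}) (at_right 0)"
      by (rule eventually_at_right_real) simp
    ultimately have "eventually (\<lambda>t. inner v d - e * norm d - (f y - f x)
        \<le> \<rho> / 2 * (1 - t) * (norm d)\<^sup>2) (at_right 0)"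
    proof eventually_elim
      case (elim t)
      then have t: "0 < t" "t < 1" by auto
      have "- e < (f (x + t *\<^sub>R d) - f x - t * inner v d) / (t * norm d)"
        using elim t by simp
      then have "- e * (t * norm d) < f (x + t *\<^sub>R d) - f x - t * inner v d"
        using t \<open>d \<noteq> 0\<close> by (subst (asm) pos_less_divide_eq) auto
      moreover have "f (x + t *\<^sub>R d) \<le> (1 - t) * f x + t * f y + \<rho> / 2 * t * (1 - t) * (norm d)\<^sup>2"
        using weakly_convexD[OF wc, of t x y] t by (simp add: d_def)
      ultimately have "t * (inner v d - e * norm d - (f y - f x)) \<le> t * (\<rho> / 2 * (1 - t) * (norm d)\<^sup>2)"
        by (simp add: field_simps)
      then show ?case using t by (simp only: mult_le_cancel_left_pos)
    qed
    from tendsto_lowerbound[OF lim0 this] show ?thesis by simp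
  qed
  have "((\<lambda>e. inner v d - e * norm d - \<rho> / 2 * (norm d)\<^sup>2)
      \<longlongrightarrow> inner v d - 0 * norm d - \<rho> / 2 * (norm d)\<^sup>2) (at_right 0)"
    by (intro tendsto_intros)
  moreover have "eventually (\<lambda>e. inner v d - e * norm d - \<rho> / 2 * (norm d)\<^sup>2 \<le> f y - f x) (at_right 0)"
    using approx by (auto simp: eventually_at_filter)
  ultimately have "inner v d - 0 * norm d - \<rho> / 2 * (norm d)\<^sup>2 \<le> f y - f x"
    by (rule tendsto_upperbound) simp
  then show ?thesis by (simp add: d_def)
qed simp

text \<open>A subgradient \<open>w\<close> of the convexified function is shifted by the gradient
  \<open>\<rho> *\<^sub>R x\<close> of the added term. This gives \<open>subdiff_norm\<close> a
  genuine infimum and the envelope problem its coercivity.\<close>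

lemma frechet_subdiff_nonempty:
  fixes f :: "'a::euclidean_space \<Rightarrow> real"
  assumes "weakly_convex \<rho> f"
  shows "frechet_subdiff f x \<noteq> {}"
proof -
  obtain w where w: "\<And>y. f x + \<rho> / 2 * (norm x)\<^sup>2 + inner w (y - x) \<le> f y + \<rho> / 2 * (norm y)\<^sup>2"
    using convex_on_subgradient_exists[of "\<lambda>y. f y + \<rho> / 2 * (norm y)\<^sup>2" x] assms
    unfolding weakly_convex_def by metis
  have "w - \<rho> *\<^sub>R x \<in> frechet_subdiff f x"
  proof (rule frechet_subdiffI)
    fix y
    have "\<rho> / 2 * (norm y)\<^sup>2 - \<rho> / 2 * (norm x)\<^sup>2 - \<rho> * inner x (y - x) = \<rho> / 2 * (norm (y - x))\<^sup>2"
      by (simp add: power2_norm_eq_inner inner_simps inner_commute algebra_simps)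
    then show "f x + inner (w - \<rho> *\<^sub>R x) (y - x) - \<rho> / 2 * (norm (y - x))\<^sup>2 \<le> f y"
      using w[of y] by (simp add: inner_diff_left)
  qed
  then show ?thesis by blast
qed

lemma continuous_on_weakly_convex:
  fixes f :: "'a::euclidean_space \<Rightarrow> real"
  assumes "weakly_convex \<rho> f"
  shows "continuous_on UNIV f"
proof -
  have "continuous_on UNIV (\<lambda>x. (f x + \<rho> / 2 * (norm x)\<^sup>2) - \<rho> / 2 * (norm x)\<^sup>2)"
    using assms unfolding weakly_convex_def
    by (intro continuous_intros convex_on_continuous) auto
  then show ?thesis by simp
qed

section \<open>Proximal points and the Moreau envelope\<close>

lemma quadratic_lower_bound:
  fixes v e :: "'a::real_inner"
  assumes "m > 0"
  shows "- (norm v)\<^sup>2 / (2 * m) \<le> inner v e + m / 2 * (norm e)\<^sup>2"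
proof -
  \<comment> \<open>Completing the square; equality holds at \<open>e = - v / m\<close>.\<close>
  have "0 \<le> (norm (v + m *\<^sub>R e))\<^sup>2 / (2 * m)"
    using assms by simp
  also have "(norm (v + m *\<^sub>R e))\<^sup>2 = (norm v)\<^sup>2 + 2 * m * (inner v e + m / 2 * (norm e)\<^sup>2)"
    by (simp add: power2_norm_eq_inner inner_simps inner_commute algebra_simps)
  finally show ?thesis
    using assms by (simp add: add_divide_distrib)
qed

lemma proximal_bound:
  assumes "weakly_convex \<rho> f" "\<rho> < \<beta>" "v \<in> frechet_subdiff f x"
  shows "f x - (norm v)\<^sup>2 / (2 * (\<beta> - \<rho>)) \<le> f y + \<beta> / 2 * (norm (y - x))\<^sup>2"
  using frechet_subdiff_weakly_convexD[OF assms(1,3), of y]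
    quadratic_lower_bound[of "\<beta> - \<rho>" v "y - x"] assms(2)
  by (simp add: diff_divide_distrib algebra_simps)

lemma proximal_point_exists:
  fixes f :: "'a::euclidean_space \<Rightarrow> real"
  assumes wc: "weakly_convex \<rho> f" and "\<rho> < \<beta>"
  obtains p where "\<And>y. f p + \<beta> / 2 * (norm (p - x))\<^sup>2 \<le> f y + \<beta> / 2 * (norm (y - x))\<^sup>2"
proof -
  let ?\<phi> = "\<lambda>y. f y + \<beta> / 2 * (norm (y - x))\<^sup>2"
  define \<mu> where "\<mu> = \<beta> - \<rho>"
  have "\<mu> > 0" using assms by (simp add: \<mu>_def)
  obtain v where v: "v \<in> frechet_subdiff f x"
    using frechet_subdiff_nonempty[OF wc] by blast
  \<comment> \<open>Beyond this radius \<open>\<mu> / 2 * (norm (y - x))\<^sup>2\<close> outweighs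
    the linear term, so the objective is at least its value \<open>f x\<close> at the centre, and a
    minimum over the ball is global.\<close>
  define r where "r = 2 * norm v / \<mu>"
  have "r \<ge> 0" using \<open>\<mu> > 0\<close> by (simp add: r_def)
  have "continuous_on (cball x r) ?\<phi>"
    by (intro continuous_intros continuous_on_subset[OF continuous_on_weakly_convex[OF wc]]) auto
  moreover have "cball x r \<noteq> {}" using \<open>r \<ge> 0\<close> by simp
  ultimately obtain p where p: "\<And>y. y \<in> cball x r \<Longrightarrow> ?\<phi> p \<le> ?\<phi> y"
    using continuous_attains_inf[of "cball x r" ?\<phi>] compact_cball by metis
  have "?\<phi> p \<le> ?\<phi> y" for y
  proof (cases "y \<in> cball x r")
    case False
    then have "r * \<mu> \<le> norm (y - x) * \<mu>"
      using \<open>\<mu> > 0\<close> by (intro mult_right_mono) (auto simp: dist_norm norm_minus_commute)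
    then have "norm v \<le> \<mu> / 2 * norm (y - x)"
      using \<open>\<mu> > 0\<close> by (simp add: r_def algebra_simps)
    then have "norm v * norm (y - x) \<le> \<mu> / 2 * norm (y - x) * norm (y - x)"
      by (intro mult_right_mono) auto
    moreover have "\<bar>inner v (y - x)\<bar> \<le> norm v * norm (y - x)"
      by (rule Cauchy_Schwarz_ineq2)
    ultimately have "0 \<le> inner v (y - x) + \<mu> / 2 * (norm (y - x))\<^sup>2"
      by (simp add: power2_eq_square)
    then have "f x \<le> ?\<phi> y"
      using frechet_subdiff_weakly_convexD[OF wc v, of y]
      by (simp add: \<mu>_def diff_divide_distrib algebra_simps)
    with p[of x] \<open>r \<ge> 0\<close> show ?thesis by simp
  qed (rule p)
  then show ?thesis by (rule that)
qed

text \<open>\<open>LEAST\<close> on the reals is determined once a minimiser is exhibited.\<close>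

lemma moreau_envelope_eq:
  assumes "\<And>y. f p + \<beta> / 2 * (norm (p - x))\<^sup>2 \<le> f y + \<beta> / 2 * (norm (y - x))\<^sup>2"
  shows "moreau_envelope \<beta> f x = f p + \<beta> / 2 * (norm (p - x))\<^sup>2"
  unfolding moreau_envelope_def using assms by (intro Least_equality) auto

text \<open>Expanding the penalty around \<open>p\<close> turns minimality into a quadratic minorant
  of \<open>f\<close> with slope \<open>\<beta> *\<^sub>R (x - p)\<close>.\<close>

lemma proximal_subgradient:
  assumes "\<And>y. f p + \<beta> / 2 * (norm (p - x))\<^sup>2 \<le> f y + \<beta> / 2 * (norm (y - x))\<^sup>2"
  shows "\<beta> *\<^sub>R (x - p) \<in> frechet_subdiff f p"
proof (rule frechet_subdiffI)
  fix y
  have "\<beta> / 2 * (norm (y - x))\<^sup>2 - \<beta> / 2 * (norm (p - x))\<^sup>2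
      = \<beta> / 2 * (norm (y - p))\<^sup>2 - inner (\<beta> *\<^sub>R (x - p)) (y - p)"
    by (simp add: power2_norm_eq_inner inner_simps inner_commute algebra_simps)
  then show "f p + inner (\<beta> *\<^sub>R (x - p)) (y - p) - \<beta> / 2 * (norm (y - p))\<^sup>2 \<le> f y"
    using assms[of y] by simp
qed

section \<open>Gradient of the envelope and the approximation property\<close>

lemma gderiv_quadratic_bounds:
  assumes "\<And>y. \<bar>F y - F x - inner v (y - x)\<bar> \<le> C * (norm (y - x))\<^sup>2"
  shows "GDERIV F x :> v"
  unfolding gderiv_def has_derivative_at
proof (intro conjI)
  show "bounded_linear (\<lambda>h. inner h v)"
    by (rule bounded_linear_inner_left)
  show "(\<lambda>h. norm (F (x + h) - F x - inner h v) / norm h) \<midarrow>0\<rightarrow> 0"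
  proof (rule tendsto_sandwich[of "\<lambda>_. 0" _ _ "\<lambda>h. C * norm h"])
    have "norm (F (x + h) - F x - inner h v) / norm h \<le> C * norm h" if "h \<noteq> 0" for h
      using assms[of "x + h"] that by (simp add: inner_commute field_simps power2_eq_square)
    then show "eventually (\<lambda>h. norm (F (x + h) - F x - inner h v) / norm h \<le> C * norm h) (at 0)"
      by (auto simp: eventually_at_filter)
    have "((\<lambda>h::'a. C * norm h) \<longlongrightarrow> C * norm (0::'a)) (at 0)"
      by (intro tendsto_intros)
    then show "((\<lambda>h::'a. C * norm h) \<longlongrightarrow> 0) (at 0)" by simp
  qed auto
qed

theorem theorem4p2:
  fixes f :: "real ^ 'd \<Rightarrow> real" and \<rho> \<eta> \<beta> :: real
  assumes "\<rho> > 0"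
    and "weakly_convex \<rho> f"
    and "\<eta> > 0"
    and "\<beta> = \<rho> + max (inverse \<eta>) \<rho>"
  shows "smooth_approximation (2 * \<rho>)
           (\<lambda>x. \<eta> / (2 * max 1 (\<rho> * \<eta>)) * (subdiff_norm f x)\<^sup>2)
           (\<lambda>x y. 2 * \<rho> + inverse \<eta>)
           f (moreau_envelope \<beta> f)"
proof -
  define \<mu> where "\<mu> = max (inverse \<eta>) \<rho>"
  \<comment> \<open>The second bound on \<open>\<mu>\<close> gives
    \<open>\<beta> \<le> 2 * \<mu>\<close>, used for curvature and nonexpansiveness; the third
    bounds \<open>\<beta>\<close> by the Lipschitz constant.\<close>
  have \<beta>: "\<beta> = \<rho> + \<mu>" and \<mu>: "\<mu> > 0" "\<rho> \<le> \<mu>" "\<mu> \<le> \<rho> + inverse \<eta>"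
    using assms by (auto simp: \<mu>_def)
  have \<beta>_bounds: "\<rho> < \<beta>" "0 < \<beta>" "\<beta> \<le> 2 * \<rho> + inverse \<eta>"
    using \<beta> \<mu> assms(1) by auto
  have R_eq: "\<eta> / (2 * max 1 (\<rho> * \<eta>)) = 1 / (2 * \<mu>)"
  proof -
    have "max 1 (\<rho> * \<eta>) = \<mu> * \<eta>"
      using assms(3) by (simp add: \<mu>_def max_mult_distrib_right)
    then show ?thesis using assms(3) by simp
  qed
  let ?F = "moreau_envelope \<beta> f"
  have "\<forall>x. \<exists>p. \<forall>y. f p + \<beta> / 2 * (norm (p - x))\<^sup>2 \<le> f y + \<beta> / 2 * (norm (y - x))\<^sup>2"
    using proximal_point_exists[OF assms(2) \<beta>_bounds(1)] by metis
  then obtain p where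
    p: "\<And>x y. f (p x) + \<beta> / 2 * (norm (p x - x))\<^sup>2 \<le> f y + \<beta> / 2 * (norm (y - x))\<^sup>2"
    by metis
  have F_eq: "?F x = f (p x) + \<beta> / 2 * (norm (p x - x))\<^sup>2" for x
    by (rule moreau_envelope_eq) (rule p)
  define g where "g x = \<beta> *\<^sub>R (x - p x)" for x
  \<comment> \<open>Minimality alone yields this with \<open>\<beta>\<close>; passing through the
    Frechet subdifferential improves the constant to \<open>\<rho>\<close>.\<close>
  have below: "f (p x) + inner (g x) (y - p x) - \<rho> / 2 * (norm (y - p x))\<^sup>2 \<le> f y" for x y
    unfolding g_def
    by (intro frechet_subdiff_weakly_convexD[OF assms(2)] proximal_subgradient p)

  have upper: "?F y \<le> ?F x + inner (g x) (y - x) + \<beta> / 2 * (norm (y - x))\<^sup>2" for x y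
  proof -
    have "?F y \<le> f (p x) + \<beta> / 2 * (norm (p x - y))\<^sup>2"
      unfolding F_eq by (rule p)
    also have "\<dots> = ?F x + inner (g x) (y - x) + \<beta> / 2 * (norm (y - x))\<^sup>2"
      by (simp add: F_eq g_def power2_norm_eq_inner inner_simps inner_commute algebra_simps)
    finally show ?thesis .
  qed
  \<comment> \<open>The unreduced \<open>2 * \<rho> / 2\<close> matches
    \<open>weakly_convexI\<close> with \<open>c = 2 * \<rho>\<close>.\<close>
  have lower: "?F x + inner (g x) (y - x) - 2 * \<rho> / 2 * (norm (y - x))\<^sup>2 \<le> ?F y" for x y
  proof -
    define d e where "d = y - x" and "e = p y - p x"
    \<comment> \<open>Expand \<open>p y - y = (p x - x) + (e - d)\<close>. The term
      \<open>- inner (g x) e\<close> then cancels against \<open>below\<close>, leaving the slope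
      along \<open>d\<close>.\<close>
    have "\<beta> / 2 * (norm (p y - y))\<^sup>2
        = \<beta> / 2 * (norm (p x - x))\<^sup>2 + inner (g x) (d - e) + \<beta> / 2 * (norm (e - d))\<^sup>2"
      by (simp add: d_def e_def g_def power2_norm_eq_inner inner_simps inner_commute algebra_simps)
    then have "?F y - ?F x - inner (g x) d \<ge> \<beta> / 2 * (norm (e - d))\<^sup>2 - \<rho> / 2 * (norm e)\<^sup>2"
      using below[of x "p y"] by (simp add: F_eq e_def[symmetric] inner_diff_right field_simps)
    moreover have "\<beta> / 2 * (norm (e - d))\<^sup>2 - \<rho> / 2 * (norm e)\<^sup>2
        = \<beta> / 2 * (norm d)\<^sup>2 + (inner (- \<beta> *\<^sub>R d) e + \<mu> / 2 * (norm e)\<^sup>2)"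
      by (simp add: \<beta> power2_norm_eq_inner inner_simps inner_commute field_simps)
    moreover have "- (norm (- \<beta> *\<^sub>R d))\<^sup>2 / (2 * \<mu>) \<le> inner (- \<beta> *\<^sub>R d) e + \<mu> / 2 * (norm e)\<^sup>2"
      using \<mu>(1) by (rule quadratic_lower_bound)
    moreover have "- \<rho> * (norm d)\<^sup>2 \<le> \<beta> / 2 * (norm d)\<^sup>2 - (norm (- \<beta> *\<^sub>R d))\<^sup>2 / (2 * \<mu>)"
    proof -
      \<comment> \<open>Minimising over \<open>e\<close> leaves the coefficient \<open>\<beta> / 2 -
        \<beta>\<^sup>2 / (2 * \<mu>) = - \<beta> * \<rho> / (2 * \<mu>)\<close>.\<close>
      have "\<beta> * \<rho> \<le> 2 * \<mu> * \<rho>"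
        using \<beta> \<mu>(2) assms(1) by (intro mult_right_mono) auto
      then have "- \<rho> \<le> \<beta> / 2 - \<beta>\<^sup>2 / (2 * \<mu>)"
        using \<mu>(1) by (simp add: \<beta> field_simps power2_eq_square)
      then have "- \<rho> * (norm d)\<^sup>2 \<le> (\<beta> / 2 - \<beta>\<^sup>2 / (2 * \<mu>)) * (norm d)\<^sup>2"
        by (rule mult_right_mono) simp
      then show ?thesis by (simp add: algebra_simps power_mult_distrib)
    qed
    ultimately show ?thesis by (simp add: d_def[symmetric])
  qed

  have gderiv: "GDERIV ?F x :> g x" for x
  proof (rule gderiv_quadratic_bounds)
    fix y
    have "\<rho> * (norm (y - x))\<^sup>2 \<le> (\<beta> + \<rho>) * (norm (y - x))\<^sup>2"
         "\<beta> / 2 * (norm (y - x))\<^sup>2 \<le> (\<beta> + \<rho>) * (norm (y - x))\<^sup>2"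
      using \<beta>_bounds(2) assms(1) by (intro mult_right_mono; simp)+
    then show "\<bar>?F y - ?F x - inner (g x) (y - x)\<bar> \<le> (\<beta> + \<rho>) * (norm (y - x))\<^sup>2"
      using upper[of y x] lower[of x y] by (auto simp: abs_le_iff)
  qed

  have lipschitz: "norm (g x - g y) \<le> (2 * \<rho> + inverse \<eta>) * norm (x - y)" for x y
  proof -
    define d e where "d = y - x" and "e = p y - p x"
    \<comment> \<open>Adding the two minorants cancels the values of \<open>f\<close>.\<close>
    have "inner (g x) (p y - p x) + inner (g y) (p x - p y) \<le> \<rho> * (norm e)\<^sup>2"
      using below[of x "p y"] below[of y "p x"]
      by (simp add: e_def norm_minus_commute)
    moreover have "inner (g x) (p y - p x) + inner (g y) (p x - p y)
        = \<beta> * (norm e)\<^sup>2 - \<beta> * inner d e"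
      by (simp add: d_def e_def g_def power2_norm_eq_inner inner_simps inner_commute algebra_simps)
    ultimately have mono: "\<mu> * (norm e)\<^sup>2 \<le> \<beta> * inner d e"
      by (simp add: \<beta> algebra_simps)
    have "\<beta> * (norm e)\<^sup>2 \<le> (2 * \<mu>) * (norm e)\<^sup>2"
      using \<beta> \<mu>(2) by (intro mult_right_mono) auto
    with mono have "\<beta> * (norm e)\<^sup>2 \<le> \<beta> * (2 * inner d e)"
      by simp
    \<comment> \<open>This is \<open>norm (d - e) \<le> norm d\<close> in squared form, and
      \<open>d - e\<close> is the increment of \<open>x - p x\<close>.\<close>
    then have "(norm e)\<^sup>2 \<le> 2 * inner d e"
      using \<beta>_bounds(2) by simp
    then have "(norm (d - e))\<^sup>2 \<le> (norm d)\<^sup>2"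
      by (simp add: power2_norm_eq_inner inner_simps inner_commute algebra_simps)
    then have "norm (d - e) \<le> norm d"
      by (rule power2_le_imp_le) simp
    moreover have "g x - g y = - \<beta> *\<^sub>R (d - e)"
      by (simp add: g_def d_def e_def algebra_simps)
    ultimately have "norm (g x - g y) \<le> \<beta> * norm (x - y)"
      using \<beta>_bounds(2) by (simp add: d_def norm_minus_commute)
    also have "\<dots> \<le> (2 * \<rho> + inverse \<eta>) * norm (x - y)"
      using \<beta>_bounds(3) by (rule mult_right_mono) simp
    finally show ?thesis .
  qed
  have "(2 * \<rho> + inverse \<eta>)-lipschitz_on UNIV g"
    using lipschitz assms(1,3) by (auto simp: lipschitz_on_def dist_norm)
  then have cont: "continuous_on UNIV g"
    by (rule lipschitz_on_continuous_on)

  have F_le: "?F x \<le> f x" for x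
    using p[of x x] by (simp add: F_eq)
  have le_F: "f x \<le> ?F x + 1 / (2 * \<mu>) * (subdiff_norm f x)\<^sup>2" for x
  proof -
    \<comment> \<open>The infimum in \<open>subdiff_norm\<close> runs over \<open>norm v\<close>,
      not its square, so the bound is put in root form before taking it.\<close>
    have "sqrt (2 * \<mu> * (f x - ?F x)) \<le> norm v" if "v \<in> frechet_subdiff f x" for v
    proof (rule real_le_lsqrt[THEN order_trans])
      have "f x - ?F x \<le> (norm v)\<^sup>2 / (2 * \<mu>)"
        using proximal_bound[OF assms(2) \<beta>_bounds(1) that, of "p x"] F_eq[of x] by (simp add: \<beta>)
      then show "2 * \<mu> * (f x - ?F x) \<le> (norm v)\<^sup>2"
        using \<mu>(1) by (simp add: field_simps)
    qed auto
    then have "sqrt (2 * \<mu> * (f x - ?F x)) \<le> subdiff_norm f x"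
      unfolding subdiff_norm_def
      using frechet_subdiff_nonempty[OF assms(2)] by (intro cINF_greatest)
    then have "2 * \<mu> * (f x - ?F x) \<le> (subdiff_norm f x)\<^sup>2"
      by (rule sqrt_le_D)
    then show ?thesis
      using \<mu>(1) by (simp add: field_simps)
  qed

  show ?thesis
    unfolding smooth_approximation_def R_eq
    using assms(1,3) \<mu>(1) weakly_convexI[OF lower] F_le le_F gderiv cont lipschitz
    by auto
qed

end
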